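(* For every typing context $\Gamma$, type $\tau$ and unrestricted $\lambda_\epsilon$-terms $t,t'$: if $\Gamma\vdash t:\tau$ and $t\to t'$, then $\Gamma\vdash t':\tau$.
   Context: Unrestricted terms: $t ::= x \mid \lambda x.t \mid (s\ t) \mid \mathsf{D}(s)\cdot t \mid \epsilon t \mid s+t \mid 0$, up to $\alpha$-equivalence. $t[s/x]$ is capture-avoiding substitution. Differential substitution $\frac{\partial t}{\partial x}(s)$ (for $x$ not free in $s$): $\frac{\partial x}{\partial x}(s)=s$; $\frac{\partial y}{\partial x}(s)=0$ ($y\ne x$); $\frac{\partial(\lambda y.t)}{\partial x}(s)=\lambda y.\frac{\partial t}{\partial x}(s)$; $\frac{\partial(t\ e)}{\partial x}(s)=\big((\mathsf{D}(t)\cdot\frac{\partial e}{\partial x}(s))\ e\big)+\big(\frac{\partial t}{\partial x}(s)\ (e[x+\epsilon s/x])\big)$; $\frac{\partial(\mathsf{D}(t)\cdot e)}{\partial x}(s)=\mathsf{D}(t)\cdot\frac{\partial e}{\partial x}(s)+\mathsf{D}(\frac{\partial t}{\partial x}(s))\cdot(e[x+\epsilon s/x])+\epsilon\big(\mathsf{D}(\mathsf{D}(t)\cdot e)\cdot\frac{\partial e}{\partial x}(s)\big)$; $\frac{\partial(\epsilon t)}{\partial x}(s)=\epsilon\frac{\partial t}{\partial x}(s)$; $\frac{\partial(t+e)}{\partial x}(s)=\frac{\partial t}{\partial x}(s)+\frac{\partial e}{\partial x}(s)$; $\frac{\partial 0}{\partial x}(s)=0$. One-step reduction $\to$ is the closure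 under term contexts (reduction inside any subterm) of $(\lambda x.t)\ s\to t[s/x]$ and $\mathsf{D}(\lambda x.t)\cdot s\to\lambda x.\frac{\partial t}{\partial x}(s)$. Types: $\sigma,\tau ::= \mathbf{t}\mid\sigma\Rightarrow\tau$ over base types; contexts are lists of distinct typed variables. Typing rules: $\Gamma\vdash x:\tau$ if $x:\tau$ occurs in $\Gamma$; from $\Gamma\vdash s:\tau\Rightarrow\sigma$ and $\Gamma\vdash t:\tau$ infer $\Gamma\vdash(s\ t):\sigma$ and $\Gamma\vdash\mathsf{D}(s)\cdot t:\tau\Rightarrow\sigma$; from $\Gamma,x:\tau\vdash t:\sigma$ infer $\Gamma\vdash\lambda x.t:\tau\Rightarrow\sigma$; $\Gamma\vdash 0:\tau$ for every $\tau$; from $\Gamma\vdash s:\tau$, $\Gamma\vdash t:\tau$ infer $\Gamma\vdash s+t:\tau$; from $\Gamma\vdash t:\tau$ infer $\Gamma\vdash\epsilon t:\tau$. *)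

theory Defs
  imports Main
begin

text \<open>
  Unrestricted terms up to alpha-equivalence, with de Bruijn indices: \<open>Var n\<close> is bound by the
  \<open>n\<close>-th enclosing abstraction, counting from 0, and indices that exceed the number of enclosing
  abstractions are free variables. \<open>Diff s t\<close> is \<open>D(s) \<cdot> t\<close>.
\<close>

datatype trm =
    Var nat
  | Lam trm
  | App trm trm
  | Diff trm trm
  | Epsilon trm
  | Plus trm trm
  | Zero

primrec rename :: "(nat \<Rightarrow> nat) \<Rightarrow> trm \<Rightarrow> trm" where
  "rename f (Var n) = Var (f n)"
| "rename f (Lam t) = Lam (rename (case_nat 0 (\<lambda>n. Suc (f n))) t)"
| "rename f (App s t) = App (rename f s) (rename f t)"
| "rename f (Diff s t) = Diff (rename f s) (rename f t)"
| "rename f (Epsilon t) = Epsilon (rename f t)"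
| "rename f (Plus s t) = Plus (rename f s) (rename f t)"
| "rename f Zero = Zero"

abbreviation lift :: "trm \<Rightarrow> trm" where
  "lift \<equiv> rename Suc"

text \<open>
  Simultaneous capture-avoiding substitution. The single substitution \<open>t[s/x]\<close> has two
  instances: \<open>subst (case_nat s Var) t\<close> if \<open>x\<close> is the index 0 and its binder disappears (so that
  the remaining indices decrease by one), and \<open>subst (Var(k := s)) t\<close> if \<open>x\<close> is the index \<open>k\<close>
  and stays in scope.
\<close>

primrec subst :: "(nat \<Rightarrow> trm) \<Rightarrow> trm \<Rightarrow> trm" where
  "subst \<theta> (Var n) = \<theta> n"
| "subst \<theta> (Lam t) = Lam (subst (case_nat (Var 0) (\<lambda>n. lift (\<theta> n))) t)"
| "subst \<theta> (App s t) = App (subst \<theta> s) (subst \<theta> t)"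
| "subst \<theta> (Diff s t) = Diff (subst \<theta> s) (subst \<theta> t)"
| "subst \<theta> (Epsilon t) = Epsilon (subst \<theta> t)"
| "subst \<theta> (Plus s t) = Plus (subst \<theta> s) (subst \<theta> t)"
| "subst \<theta> Zero = Zero"

text \<open>
  \<open>dsubst k s t\<close> is the differential substitution of \<open>s\<close> for the index \<open>k\<close> in \<open>t\<close>. The index \<open>k\<close>
  may still occur in the result, so \<open>s\<close>, \<open>t\<close> and the result all live in one scope, which contains
  \<open>k\<close>. It is meant for \<open>k\<close> not free in \<open>s\<close>; this holds wherever the reduction relation uses it.
\<close>

primrec dsubst :: "nat \<Rightarrow> trm \<Rightarrow> trm \<Rightarrow> trm" where
  "dsubst k s (Var n) = (if n = k then s else Zero)"
| "dsubst k s (Lam t) = Lam (dsubst (Suc k) (lift s) t)"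
| "dsubst k s (App t e) =
     Plus (App (Diff t (dsubst k s e)) e)
          (App (dsubst k s t) (subst (Var(k := Plus (Var k) (Epsilon s))) e))"
| "dsubst k s (Diff t e) =
     Plus (Plus (Diff t (dsubst k s e))
                (Diff (dsubst k s t) (subst (Var(k := Plus (Var k) (Epsilon s))) e)))
          (Epsilon (Diff (Diff t e) (dsubst k s e)))"
| "dsubst k s (Epsilon t) = Epsilon (dsubst k s t)"
| "dsubst k s (Plus t e) = Plus (dsubst k s t) (dsubst k s e)"
| "dsubst k s Zero = Zero"

text \<open>
  In \<open>step_diff\<close> the argument moves under the binder, hence \<open>lift s\<close>, in which the index 0 is not
  free.
\<close>

inductive step :: "trm \<Rightarrow> trm \<Rightarrow> bool" (infix "\<rightarrow>\<^sub>\<epsilon>" 50) where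
  step_beta: "App (Lam t) s \<rightarrow>\<^sub>\<epsilon> subst (case_nat s Var) t"
| step_diff: "Diff (Lam t) s \<rightarrow>\<^sub>\<epsilon> Lam (dsubst 0 (lift s) t)"
| step_Lam: "t \<rightarrow>\<^sub>\<epsilon> t' \<Longrightarrow> Lam t \<rightarrow>\<^sub>\<epsilon> Lam t'"
| step_App1: "s \<rightarrow>\<^sub>\<epsilon> s' \<Longrightarrow> App s t \<rightarrow>\<^sub>\<epsilon> App s' t"
| step_App2: "t \<rightarrow>\<^sub>\<epsilon> t' \<Longrightarrow> App s t \<rightarrow>\<^sub>\<epsilon> App s t'"
| step_Diff1: "s \<rightarrow>\<^sub>\<epsilon> s' \<Longrightarrow> Diff s t \<rightarrow>\<^sub>\<epsilon> Diff s' t"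
| step_Diff2: "t \<rightarrow>\<^sub>\<epsilon> t' \<Longrightarrow> Diff s t \<rightarrow>\<^sub>\<epsilon> Diff s t'"
| step_Eps: "t \<rightarrow>\<^sub>\<epsilon> t' \<Longrightarrow> Epsilon t \<rightarrow>\<^sub>\<epsilon> Epsilon t'"
| step_Plus1: "s \<rightarrow>\<^sub>\<epsilon> s' \<Longrightarrow> Plus s t \<rightarrow>\<^sub>\<epsilon> Plus s' t"
| step_Plus2: "t \<rightarrow>\<^sub>\<epsilon> t' \<Longrightarrow> Plus s t \<rightarrow>\<^sub>\<epsilon> Plus s t'"

datatype 'b ty = Base 'b | Fun "'b ty" "'b ty" (infixr "\<rightarrow>\<^sub>t" 65)

text \<open>
  A context is the list of the types of its variables, the most recently bound one first: position
  \<open>n\<close> is the variable with index \<open>n\<close>, so the variables are distinct by construction.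
\<close>

inductive typing :: "'b ty list \<Rightarrow> trm \<Rightarrow> 'b ty \<Rightarrow> bool" ("_ \<turnstile> _ : _" [50, 50, 50] 50) where
  typing_Var: "n < length \<Gamma> \<Longrightarrow> \<Gamma> ! n = \<tau> \<Longrightarrow> \<Gamma> \<turnstile> Var n : \<tau>"
| typing_App: "\<Gamma> \<turnstile> s : \<tau> \<rightarrow>\<^sub>t \<sigma> \<Longrightarrow> \<Gamma> \<turnstile> t : \<tau> \<Longrightarrow> \<Gamma> \<turnstile> App s t : \<sigma>"
| typing_Diff: "\<Gamma> \<turnstile> s : \<tau> \<rightarrow>\<^sub>t \<sigma> \<Longrightarrow> \<Gamma> \<turnstile> t : \<tau> \<Longrightarrow> \<Gamma> \<turnstile> Diff s t : \<tau> \<rightarrow>\<^sub>t \<sigma>"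
| typing_Lam: "\<tau> # \<Gamma> \<turnstile> t : \<sigma> \<Longrightarrow> \<Gamma> \<turnstile> Lam t : \<tau> \<rightarrow>\<^sub>t \<sigma>"
| typing_Zero: "\<Gamma> \<turnstile> Zero : \<tau>"
| typing_Plus: "\<Gamma> \<turnstile> s : \<tau> \<Longrightarrow> \<Gamma> \<turnstile> t : \<tau> \<Longrightarrow> \<Gamma> \<turnstile> Plus s t : \<tau>"
| typing_Eps: "\<Gamma> \<turnstile> t : \<tau> \<Longrightarrow> \<Gamma> \<turnstile> Epsilon t : \<tau>"

end

theory Submission
  imports Defs
begin

text \<open>Types do not separate points from tangent vectors: \<open>Diff s t\<close> has the type
  of \<open>s\<close>, and both \<open>Epsilon\<close> and \<open>Plus\<close> stay within one type.
  Hence replacing a variable by a term of its type, or differentiating along such a term, leaves the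
  type of a term unchanged. These two facts, \<open>typing_subst\<close> and
  \<open>typing_dsubst\<close>, settle the two redexes; inversion of the typing rules carries the
  result through term contexts.\<close>

inductive_cases typing_AppE: "\<Gamma> \<turnstile> App s t : \<tau>"
inductive_cases typing_DiffE: "\<Gamma> \<turnstile> Diff s t : \<tau>"
inductive_cases typing_LamE: "\<Gamma> \<turnstile> Lam t : \<tau>"
inductive_cases typing_PlusE: "\<Gamma> \<turnstile> Plus s t : \<tau>"
inductive_cases typing_EpsE: "\<Gamma> \<turnstile> Epsilon t : \<tau>"

text \<open>Weakening is the case \<open>f = Suc\<close>; an arbitrary \<open>f\<close> is needed
  because the induction shifts it under each binder.\<close>

lemma typing_rename:
  assumes "\<Gamma> \<turnstile> t : \<tau>"
    and "\<And>n. n < length \<Gamma> \<Longrightarrow> f n < length \<Delta> \<and> \<Delta> ! f n = \<Gamma> ! n"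
  shows "\<Delta> \<turnstile> rename f t : \<tau>"
  using assms
proof (induction arbitrary: f \<Delta> rule: typing.induct)
  case (typing_Lam \<tau> \<Gamma> t \<sigma>)
  have "\<tau> # \<Delta> \<turnstile> rename (case_nat 0 (\<lambda>n. Suc (f n))) t : \<sigma>"
    by (rule typing_Lam.IH) (auto split: nat.split simp: typing_Lam.prems)
  then show ?case by (simp add: typing.typing_Lam)
next
  case (typing_App \<Gamma> s \<tau> \<sigma> t)
  have "\<Delta> \<turnstile> rename f s : \<tau> \<rightarrow>\<^sub>t \<sigma>" "\<Delta> \<turnstile> rename f t : \<tau>"
    by (simp_all add: typing_App.IH typing_App.prems)
  then show ?case by (simp add: typing.typing_App)
qed (auto intro: typing.intros)

lemma typing_lift:
  assumes "\<Gamma> \<turnstile> t : \<tau>"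
  shows "\<sigma> # \<Gamma> \<turnstile> lift t : \<tau>"
  using assms by (rule typing_rename) simp

text \<open>The simultaneous form covers both the beta substitution, which removes a variable, and
  the perturbation in \<open>dsubst\<close>, which keeps it.\<close>

lemma typing_subst:
  assumes "\<Gamma> \<turnstile> t : \<tau>"
    and "\<And>n. n < length \<Gamma> \<Longrightarrow> \<Delta> \<turnstile> \<theta> n : \<Gamma> ! n"
  shows "\<Delta> \<turnstile> subst \<theta> t : \<tau>"
  using assms
proof (induction arbitrary: \<theta> \<Delta> rule: typing.induct)
  case (typing_Lam \<tau> \<Gamma> t \<sigma>)
  have "\<tau> # \<Delta> \<turnstile> subst (case_nat (Var 0) (\<lambda>n. lift (\<theta> n))) t : \<sigma>"
    by (rule typing_Lam.IH)
      (auto split: nat.split simp: typing_Lam.prems intro: typing_lift typing_Var)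
  then show ?case by (simp add: typing.typing_Lam)
next
  case (typing_App \<Gamma> s \<tau> \<sigma> t)
  \<comment> \<open>The argument type \<tau> is absent from the goal, so it is supplied
    here.\<close>
  have "\<Delta> \<turnstile> subst \<theta> s : \<tau> \<rightarrow>\<^sub>t \<sigma>" "\<Delta> \<turnstile> subst \<theta> t : \<tau>"
    by (simp_all add: typing_App.IH typing_App.prems)
  then show ?case by (simp add: typing.typing_App)
qed (auto intro: typing.intros)

lemma typing_subst_eps:
  assumes "\<Gamma> \<turnstile> t : \<tau>" and "k < length \<Gamma>" and "\<Gamma> \<turnstile> s : \<Gamma> ! k"
  shows "\<Gamma> \<turnstile> subst (Var(k := Plus (Var k) (Epsilon s))) t : \<tau>"
  using assms(1) by (rule typing_subst) (auto intro: typing.intros assms(2,3))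

text \<open>The context is unchanged since index \<open>k\<close> stays in scope. At a variable the
  result is \<open>s\<close>, of the type of \<open>k\<close>, or \<open>Zero\<close>, which has
  every type.\<close>

lemma typing_dsubst:
  assumes "\<Gamma> \<turnstile> t : \<tau>" and "k < length \<Gamma>" and "\<Gamma> \<turnstile> s : \<Gamma> ! k"
  shows "\<Gamma> \<turnstile> dsubst k s t : \<tau>"
  using assms
proof (induction arbitrary: k s rule: typing.induct)
  case (typing_Lam \<tau> \<Gamma> t \<sigma>)
  have "\<tau> # \<Gamma> \<turnstile> dsubst (Suc k) (lift s) t : \<sigma>"
    by (rule typing_Lam.IH) (simp_all add: typing_Lam.prems typing_lift)
  then show ?case by (simp add: typing.typing_Lam)
next
  case (typing_App \<Gamma> t \<tau> \<sigma> e)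
  have "\<Gamma> \<turnstile> App (Diff t (dsubst k s e)) e : \<sigma>"
    using typing_App by (blast intro: typing.typing_App typing.typing_Diff)
  moreover have "\<Gamma> \<turnstile> App (dsubst k s t) (subst (Var(k := Plus (Var k) (Epsilon s))) e) : \<sigma>"
    using typing_App by (blast intro: typing.typing_App typing_subst_eps)
  ultimately show ?case by (simp add: typing.typing_Plus)
next
  case (typing_Diff \<Gamma> t \<tau> \<sigma> e)
  \<comment> \<open>All three summands have type \<tau> \<Rightarrow> \<sigma>:
    \<open>Diff t e\<close> has the type of \<open>t\<close>, so it can be differentiated again
    along the derivative of \<open>e\<close>.\<close>
  then show ?case
    by (auto intro!: typing_Plus typing_Eps intro: typing.typing_Diff typing_subst_eps)
qed (auto intro: typing.intros)

theorem mainTheorem13: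
  fixes \<Gamma> :: "'b ty list" and \<tau> :: "'b ty" and t t' :: trm
  assumes "\<Gamma> \<turnstile> t : \<tau>" and "t \<rightarrow>\<^sub>\<epsilon> t'"
  shows "\<Gamma> \<turnstile> t' : \<tau>"
  \<comment> \<open>The induction is on the reduction, with context and type left general: subterms
    have other types, and binders extend the context.\<close>
  using assms(2,1)
proof (induction arbitrary: \<Gamma> \<tau> rule: step.induct)
  case (step_beta t s)
  then obtain \<sigma> where t: "\<sigma> # \<Gamma> \<turnstile> t : \<tau>" and s: "\<Gamma> \<turnstile> s : \<sigma>"
    by (auto elim!: typing_AppE typing_LamE)
  from t show ?case
    by (rule typing_subst) (auto split: nat.split intro: s typing_Var)
next
  case (step_diff t s)
  then obtain \<sigma> \<rho> where "\<tau> = \<sigma> \<rightarrow>\<^sub>t \<rho>" "\<sigma> # \<Gamma> \<turnstile> t : \<rho>" "\<Gamma> \<turnstile> s : \<sigma>"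
    by (auto elim!: typing_DiffE typing_LamE)
  \<comment> \<open>Lifting puts \<open>s\<close> in the context extended by \<sigma>, where index 0
    has type \<sigma>; the abstraction then restores the function type.\<close>
  then show ?case by (simp add: typing_Lam typing_dsubst typing_lift)
qed (auto elim!: typing_AppE typing_DiffE typing_LamE typing_PlusE typing_EpsE
    intro: typing.intros)

end
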